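(* Let $k\ge1$, $d\ge0$, $i\ge1$, let $\left(S^{(0)}_{1,\ldots,i},S^{(1)}_{1,\ldots,i},S^{(2)}_{1,\ldots,i},S^{(3)}_{1,\ldots,i}\right)$ be a generalized rewriting rule with $S^{(m)}_j\subseteq\{0,1,2,3\}^d$, and let $h\in[k]$. Let $K\subseteq\{0,1,2,3\}^k$ be a USO and let $L:K\to[i]$ be a labelling function. Then $T_h(K,L)$ is a USO of strings in $\{0,1,2,3\}^{k+d-1}$.
   Context: Hypercubes and USOs. $[k]=\{1,\ldots,k\}$. $Q_k$ is the $k$-dimensional hypercube graph with vertex set $\{0,1\}^k$; $v\oplus i$ denotes the neighbor of $v$ differing from $v$ exactly in coordinate $i$. An orientation $O$ of $Q_k$ directs every edge; it is identified with the function $O:\{0,1\}^k\to\{0,1\}^k$ where $O(v)_i=1$ if the edge $\{v,v\oplus i\}$ is directed upwards (from its endpoint with $i$-th coordinate $0$ to its endpoint with $i$-th coordinate $1$) and $O(v)_i=0$ if it is directed downwards (so $O(v)_i=O(v\oplus i)_i$). A face is the subgraph induced by all vertices that agree with a fixed string $f\in\{0,1,*\}^k$ on the non-$*$ positions. $O$ is a Unique Sink Orientation (USO) if every face contains exactly one vertex with no outgoing edges inside that face. String encoding. An orientation $O$ of $Q_k$ is encoded as the set of $2^k$ strings $\{p(v): v\in\{0,1\}^k\}\subseteq\{0,1,2,3\}^k$ with $p(v)_i=2v_i+O(v)_i$. A set $K\subseteq\{0,1,2,3\}^k$ is said to be (or define) a $k$-dimensional USO if it is the encoding of some USO of $Q_k$.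 The only $0$-dimensional USO is $\{\varepsilon\}$, with $\varepsilon$ the empty string. Generalized rewriting rule. For $i\ge1$, a generalized rewriting rule consists of sets $S^{(m)}_j\subseteq\{0,1,2,3\}^d$ ($m\in\{0,1,2,3\}$, $j\in[i]$) such that for all $j,j'\in[i]$: (i) $S^{(0)}_j\cap S^{(2)}_{j'}=\emptyset$ and $S^{(0)}_j\cup S^{(2)}_{j'}$ defines a $d$-dimensional USO; (ii) $S^{(1)}_j\cap S^{(3)}_{j'}=\emptyset$ and $S^{(1)}_j\cup S^{(3)}_{j'}$ defines a $d$-dimensional USO. For $K\subseteq\{0,1,2,3\}^k$, a labelling $L:K\to[i]$ and $h\in[k]$, applying the rule to $K$ on dimension $h$ gives $$T_h(K,L)=\bigcup_{v\in K}\left\{v_1\cdots v_{h-1}\,t_1\cdots t_d\,v_{h+1}\cdots v_k \;\middle|\; t\in S^{(v_h)}_{L(v)}\right\}\subseteq\{0,1,2,3\}^{k+d-1}.$$ *)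

theory Defs
  imports Main "HOL-Library.FuncSet" "HOL-Library.NList"
begin

text \<open>Strings of length k over an alphabet A are lists in \<^term>\<open>nlists k A\<close>. Coordinates are
  numbered from 1, so the i-th coordinate of a string v is the list entry \<^term>\<open>v ! (i - 1)\<close>.\<close>

abbreviation cube :: "nat \<Rightarrow> nat list set" where
  "cube k \<equiv> nlists k {0, 1}"

abbreviation quat :: "nat \<Rightarrow> nat list set" where
  "quat k \<equiv> nlists k {0, 1, 2, 3}"

definition flip :: "nat list \<Rightarrow> nat \<Rightarrow> nat list" where
  "flip v i = v[i - 1 := 1 - v ! (i - 1)]"

text \<open>The i-th entry of \<^term>\<open>O' v\<close> is 1 if the edge between v and \<^term>\<open>flip v i\<close> is directed
  upwards and 0 if it is directed downwards. Only the values on \<^term>\<open>cube k\<close> matter.\<close>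

definition orientation :: "nat \<Rightarrow> (nat list \<Rightarrow> nat list) \<Rightarrow> bool" where
  "orientation k O' \<longleftrightarrow>
     (\<forall>v \<in> cube k. O' v \<in> cube k \<and>
        (\<forall>i \<in> {1..k}. O' v ! (i - 1) = O' (flip v i) ! (i - 1)))"

definition outgoing :: "(nat list \<Rightarrow> nat list) \<Rightarrow> nat list \<Rightarrow> nat \<Rightarrow> bool" where
  "outgoing O' v i \<longleftrightarrow>
     v ! (i - 1) = 0 \<and> O' v ! (i - 1) = 1 \<or> v ! (i - 1) = 1 \<and> O' v ! (i - 1) = 0"

text \<open>Faces are given by strings over \<^term>\<open>{None, Some 0, Some (1::nat)}\<close>, where \<^term>\<open>None\<close> plays
  the role of the wildcard symbol.\<close>

definition face :: "nat \<Rightarrow> nat option list \<Rightarrow> nat list set" where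
  "face k f =
     {v \<in> cube k. \<forall>i \<in> {1..k}. f ! (i - 1) \<noteq> None \<longrightarrow> f ! (i - 1) = Some (v ! (i - 1))}"

definition face_sink ::
  "nat \<Rightarrow> (nat list \<Rightarrow> nat list) \<Rightarrow> nat option list \<Rightarrow> nat list \<Rightarrow> bool" where
  "face_sink k O' f v \<longleftrightarrow>
     v \<in> face k f \<and> (\<forall>i \<in> {1..k}. flip v i \<in> face k f \<longrightarrow> \<not> outgoing O' v i)"

definition unique_sink_orientation :: "nat \<Rightarrow> (nat list \<Rightarrow> nat list) \<Rightarrow> bool" where
  "unique_sink_orientation k O' \<longleftrightarrow>
     orientation k O' \<and> (\<forall>f \<in> nlists k {None, Some 0, Some 1}. \<exists>!v. face_sink k O' f v)"

definition encoding :: "nat \<Rightarrow> (nat list \<Rightarrow> nat list) \<Rightarrow> nat list set" where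
  "encoding k O' = (\<lambda>v. map2 (\<lambda>a b. 2 * a + b) v (O' v)) ` cube k"

definition defines_uso :: "nat \<Rightarrow> nat list set \<Rightarrow> bool" where
  "defines_uso k K \<longleftrightarrow>
     K \<subseteq> quat k \<and> (\<exists>O'. unique_sink_orientation k O' \<and> K = encoding k O')"

lemma defines_uso_0: "defines_uso 0 K \<longleftrightarrow> K = {[]}"
proof -
  have "face_sink 0 (\<lambda>v. v) [] v \<longleftrightarrow> v = []" for v
    by (simp add: face_sink_def face_def)
  then have "unique_sink_orientation 0 (\<lambda>v. v)"
    by (simp add: unique_sink_orientation_def orientation_def)
  moreover have "encoding 0 O' = {[]}" for O'
    by (simp add: encoding_def)
  ultimately show ?thesis
    unfolding defines_uso_def nlists_n_0 by blast
qed

text \<open>\<^term>\<open>S m j\<close> is relevant only for m in \<^term>\<open>{0, 1, 2, 3::nat}\<close> and j in \<^term>\<open>{1..i::nat}\<close>.\<close>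

definition generalized_rewriting_rule ::
  "nat \<Rightarrow> nat \<Rightarrow> (nat \<Rightarrow> nat \<Rightarrow> nat list set) \<Rightarrow> bool" where
  "generalized_rewriting_rule d i S \<longleftrightarrow>
     (\<forall>m \<in> {0, 1, 2, 3}. \<forall>j \<in> {1..i}. S m j \<subseteq> quat d) \<and>
     (\<forall>j \<in> {1..i}. \<forall>j' \<in> {1..i}.
        S 0 j \<inter> S 2 j' = {} \<and> defines_uso d (S 0 j \<union> S 2 j') \<and>
        S 1 j \<inter> S 3 j' = {} \<and> defines_uso d (S 1 j \<union> S 3 j'))"

definition apply_rule ::
  "(nat \<Rightarrow> nat \<Rightarrow> nat list set) \<Rightarrow> nat \<Rightarrow> nat list set \<Rightarrow> (nat list \<Rightarrow> nat) \<Rightarrow> nat list set" where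
  "apply_rule S h K L =
     (\<Union>v \<in> K. {take (h - 1) v @ t @ drop h v | t. t \<in> S (v ! (h - 1)) (L v)})"

end

theory Submission
  imports Defs
begin

text \<open>By the Szabo-Welzl criterion, a set of quaternary strings of length k is a USO iff it has
  \<open>2 ^ k\<close> elements and any two distinct ones are separated, i.e. differ by exactly 2 in some
  coordinate (opposite bits, equally directed edge). Separation is inherited by the result of a
  rewriting step: strings coming from words that are separated away from h stay separated there,
  and otherwise the inserted parts are distinct members of a common USO. As
  \<open>card (S 0 j) + card (S 2 j') = 2 ^ d\<close> for all labels, these cardinalities do not depend on the
  label, and pairing each vertex with its neighbour in direction h gives the cardinality of the
  result.\<close>

text \<open>As a simp rule, \<open>nlistsE_length\<close> loops with the characterization \<open>nlists_iff_nth\<close> below.\<close>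

declare nlistsE_length [simp del]

section \<open>Separation of quaternary strings\<close>

definition separated :: "nat list \<Rightarrow> nat list \<Rightarrow> bool" where
  "separated p q \<longleftrightarrow> (\<exists>(a, b) \<in> set (zip p q). a + 2 = b \<or> b + 2 = a)"

lemma separated_nth:
  assumes "length p = length q"
  shows "separated p q \<longleftrightarrow> (\<exists>j<length p. p ! j + 2 = q ! j \<or> q ! j + 2 = p ! j)"
  using assms unfolding separated_def set_zip by auto

lemma not_separated_self: "\<not> separated p p"
  by (simp add: separated_nth)

text \<open>Equal lengths keep the prefixes aligned under \<open>zip\<close>. This is the form
  needed when a block replaces a single coordinate.\<close>

lemma separated_append:
  assumes "length p = length p'"
  shows "separated (p @ q) (p' @ q') \<longleftrightarrow> separated p p' \<or> separated q q'"
  using assms unfolding separated_def by auto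

lemma separated_Cons:
  "separated (a # p) (b # q) \<longleftrightarrow> a + 2 = b \<or> b + 2 = a \<or> separated p q"
  unfolding separated_def by auto

section \<open>Strings over finite alphabets and vertices of the cube\<close>

lemma ball_1_atMost: "(\<forall>i\<in>{1..k}. P i) \<longleftrightarrow> (\<forall>j<k. P (Suc j))"
  using image_Suc_lessThan[of k] by (metis imageE imageI lessThan_iff)

lemma nlists_iff_nth: "xs \<in> nlists n A \<longleftrightarrow> length xs = n \<and> (\<forall>j<n. xs ! j \<in> A)"
  unfolding nlists_def subset_eq all_set_conv_all_nth by auto

lemma nlistsI_nth:
  "length xs = n \<Longrightarrow> (\<And>j. j < n \<Longrightarrow> xs ! j \<in> A) \<Longrightarrow> xs \<in> nlists n A"
  by (simp add: nlists_iff_nth)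

lemma nlists_eq: "nlists n A = {xs. set xs \<subseteq> A \<and> length xs = n}"
  unfolding nlists_def by blast

lemma finite_nlists: "finite A \<Longrightarrow> finite (nlists n A)"
  unfolding nlists_eq by (rule finite_lists_length_eq)

lemma card_nlists: "finite A \<Longrightarrow> card (nlists n A) = card A ^ n"
  unfolding nlists_eq by (rule card_lists_length_eq)

lemma card_cube: "card (cube k) = 2 ^ k"
  by (simp add: card_nlists numeral_2_eq_2)

lemma cube_bit: "v \<in> cube k \<Longrightarrow> j < k \<Longrightarrow> v ! j = 0 \<or> v ! j = 1"
  using nlistsE_nth_in[of v k "{0, 1}" j] by simp

section \<open>Flips and faces of the cube\<close>

lemma nth_flip_Suc:
  "j < length v \<Longrightarrow> flip v (Suc n) ! j = (if j = n then 1 - v ! j else v ! j)"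
  unfolding flip_def by (cases "j = n") simp_all

lemma length_flip [simp]: "length (flip v n) = length v"
  by (simp add: flip_def)

lemma flip_in_cube:
  assumes "v \<in> cube k"
  shows "flip v (Suc n) \<in> cube k"
proof (rule nlistsI_nth)
  fix j assume j: "j < k"
  then have "flip v (Suc n) ! j = (if j = n then 1 - v ! j else v ! j)"
    using nlistsE_length[OF assms] by (simp add: nth_flip_Suc)
  then show "flip v (Suc n) ! j \<in> {0, 1}"
    using cube_bit[OF assms j] by auto
qed (simp add: nlistsE_length[OF assms])

lemma flip_flip:
  assumes "v \<in> cube k"
  shows "flip (flip v (Suc n)) (Suc n) = v"
proof (rule nth_equalityI)
  fix j assume "j < length (flip (flip v (Suc n)) (Suc n))"
  then have "j < length v" "v ! j = 0 \<or> v ! j = 1"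
    using cube_bit[OF assms, of j] nlistsE_length[OF assms] by auto
  then show "flip (flip v (Suc n)) (Suc n) ! j = v ! j"
    by (auto simp: nth_flip_Suc)
qed simp

lemma flip_neq:
  assumes "v \<in> cube k" "n < k"
  shows "flip v (Suc n) \<noteq> v"
proof -
  have "flip v (Suc n) ! n \<noteq> v ! n"
    using assms(2) cube_bit[OF assms] nlistsE_length[OF assms(1)] by (auto simp: nth_flip_Suc)
  then show ?thesis by metis
qed

lemma in_face_iff:
  "v \<in> face k f \<longleftrightarrow> v \<in> cube k \<and> (\<forall>j<k. f ! j \<noteq> None \<longrightarrow> f ! j = Some (v ! j))"
  unfolding face_def ball_1_atMost by simp

lemma flip_in_face_iff:
  assumes "v \<in> face k f" "n < k"
  shows "flip v (Suc n) \<in> face k f \<longleftrightarrow> f ! n = None"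
proof -
  have v: "v \<in> cube k" "\<forall>j<k. f ! j \<noteq> None \<longrightarrow> f ! j = Some (v ! j)"
    using assms by (auto simp: in_face_iff)
  have "length v = k" using v by (simp add: nlists_iff_nth)
  then show ?thesis
    using v assms(2) cube_bit[OF v(1) assms(2)] flip_in_cube[OF v(1), of n]
    by (auto simp: in_face_iff nth_flip_Suc)
qed

text \<open>By \<open>flip_in_face_iff\<close> the edges at \<open>v\<close> inside the face are
  those in free directions. Sinks thus become the case \<open>M = {}\<close> of the patterns
  below.\<close>

lemma face_sink_iff:
  "face_sink k O' f v \<longleftrightarrow>
     v \<in> face k f \<and> (\<forall>j<k. f ! j = None \<longrightarrow> \<not> outgoing O' v (Suc j))"
  unfolding face_sink_def ball_1_atMost using flip_in_face_iff by blast

section \<open>Facets and patterns of outgoing edges\<close>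

lemma face_update:
  assumes "f ! n = None" "n < k" "length f = k"
  shows "v \<in> face k (f[n := Some b]) \<longleftrightarrow> v \<in> face k f \<and> v ! n = b"
  using assms by (auto simp: in_face_iff nth_list_update)

text \<open>Every pattern M of outgoing edges occurs exactly once in every face. The step from M to
  \<open>insert i M\<close> is the fact that reversing all edges in direction i keeps an orientation a USO:
  of the two facets of a face in direction i, exactly one has its M-vertex as the M-vertex
  of the face, so the other one provides the vertex for \<open>insert i M\<close>.\<close>

lemma uso_unique_pattern:
  assumes "unique_sink_orientation k O'" "finite M" "f \<in> nlists k {None, Some 0, Some 1}"
  shows "\<exists>!v. v \<in> face k f \<and> (\<forall>j<k. f ! j = None \<longrightarrow> (outgoing O' v (Suc j) \<longleftrightarrow> j \<in> M))"
  using assms(2,3)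
proof (induction M arbitrary: f rule: finite_induct)
  case empty
  then show ?case
    using assms(1) by (simp add: unique_sink_orientation_def face_sink_iff)
next
  case (insert n M)
  define P where "P = (\<lambda>M f v. v \<in> face k f \<and>
    (\<forall>j<k. f ! j = None \<longrightarrow> (outgoing O' v (Suc j) \<longleftrightarrow> j \<in> M)))"
  have IH: "\<exists>!v. P M f v" if "f \<in> nlists k {None, Some 0, Some 1}" for f
    using insert.IH[OF that] unfolding P_def .
  have "\<exists>!v. P (insert n M) f v"
  proof (cases "n < k \<and> f ! n = None")
    case False
    then have "P (insert n M) f v \<longleftrightarrow> P M f v" for v
      by (auto simp: P_def)
    then show ?thesis using IH[OF insert.prems] by simp
  next
    case True
    then have n: "n < k" "f ! n = None" by auto
    have len: "length f = k" using insert.prems by (simp add: nlists_iff_nth)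
    \<comment> \<open>On a facet direction \<open>n\<close> is fixed, so the pattern says nothing
      about the edge in direction \<open>n\<close>. That edge alone decides between \<open>M\<close>
      and \<open>insert n M\<close> on the whole face.\<close>
    have facet: "P M (f[n := Some b]) v \<longleftrightarrow> v \<in> face k f \<and> v ! n = b \<and>
        (\<forall>j<k. f ! j = None \<longrightarrow> j \<noteq> n \<longrightarrow> (outgoing O' v (Suc j) \<longleftrightarrow> j \<in> M))" for b v
      unfolding P_def face_update[OF n(2,1) len] using n len
      by (auto simp: nth_list_update)
    have split: "P M f v \<longleftrightarrow> P M (f[n := Some (v ! n)]) v \<and> \<not> outgoing O' v (Suc n)"
      "P (insert n M) f v \<longleftrightarrow> P M (f[n := Some (v ! n)]) v \<and> outgoing O' v (Suc n)" for v
      unfolding facet unfolding P_def using n insert.hyps by auto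
    have ex1: "\<exists>!v. P M (f[n := Some b]) v" if "b \<in> {0, 1}" for b
      by (rule IH, rule nlists_update_in_list) (use that insert.prems in auto)
    obtain w where w: "P M f w" and w_unique: "\<And>v. P M f v \<Longrightarrow> v = w"
      using IH[OF insert.prems] by blast
    have bit: "v ! n = 0 \<or> v ! n = 1" if "P M' f' v" for M' f' v
      using that cube_bit n(1) by (auto simp: P_def in_face_iff)
    \<comment> \<open>The facet not containing \<open>w\<close>. Its \<open>M\<close>-vertex
      \<open>w'\<close> differs from \<open>w\<close>, so by uniqueness of \<open>w\<close> the edge
      of \<open>w'\<close> in direction \<open>n\<close> is outgoing.\<close>
    define b where "b = 1 - w ! n"
    have b: "b \<in> {0, 1}" "b \<noteq> w ! n" using bit[OF w] by (auto simp: b_def)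
    obtain w' where w': "P M (f[n := Some b]) w'" using ex1[OF b(1)] by blast
    then have w'_n: "w' ! n = b" by (simp add: facet)
    show ?thesis
    proof (rule ex1I[of _ w'])
      show "P (insert n M) f w'"
        using split w' w'_n w_unique b(2) by metis
    next
      fix v assume v: "P (insert n M) f v"
      then have *: "P M (f[n := Some (v ! n)]) v" "outgoing O' v (Suc n)"
        using split by auto
      \<comment> \<open>In the facet of \<open>w\<close> the \<open>M\<close>-vertex is
        \<open>w\<close> itself, whose edge in direction \<open>n\<close> is not outgoing.\<close>
      have "v ! n \<noteq> w ! n"
        using * w split(1) ex1[of "w ! n"] bit[OF w] by (metis insertCI)
      then have "v ! n = b" using bit[OF v] bit[OF w] by (auto simp: b_def)
      then show "v = w'" using * w' ex1[OF b(1)] by metis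
    qed
  qed
  then show ?case unfolding P_def .
qed

section \<open>Encodings and the Szabo-Welzl criterion\<close>

abbreviation encode :: "nat list \<Rightarrow> nat list \<Rightarrow> nat list" where
  "encode \<equiv> map2 (\<lambda>a b. 2 * a + b)"

lemma nth_encode:
  "v \<in> cube k \<Longrightarrow> w \<in> cube k \<Longrightarrow> j < k \<Longrightarrow> encode v w ! j = 2 * v ! j + w ! j"
  by (simp add: nlistsE_length)

lemma length_encode: "v \<in> cube k \<Longrightarrow> w \<in> cube k \<Longrightarrow> length (encode v w) = k"
  by (simp add: nlistsE_length)

text \<open>If \<open>u\<close> and \<open>v\<close> were not separated, then wherever they differ
  their edges would also have different directions, hence be both outgoing or both incoming. They
  would share a pattern in the smallest face containing both, against
  \<open>uso_unique_pattern\<close>.\<close>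

lemma uso_separated:
  assumes uso: "unique_sink_orientation k O'" and uv: "u \<in> cube k" "v \<in> cube k" "u \<noteq> v"
  shows "separated (encode u (O' u)) (encode v (O' v))"
proof -
  have O': "O' u \<in> cube k" "O' v \<in> cube k"
    using uso uv by (auto simp: unique_sink_orientation_def orientation_def)
  \<comment> \<open>The smallest face containing \<open>u\<close> and \<open>v\<close>; its free
    coordinates are those where they differ.\<close>
  define f where "f = map (\<lambda>j. if u ! j = v ! j then Some (u ! j) else None) [0..<k]"
  define M where "M = {j. j < k \<and> outgoing O' u (Suc j)}"
  have f: "f ! j = (if u ! j = v ! j then Some (u ! j) else None)" if "j < k" for j
    using that by (simp add: f_def)
  have "f \<in> nlists k {None, Some 0, Some 1}"
  proof (rule nlistsI_nth)
    show "f ! j \<in> {None, Some 0, Some 1}" if "j < k" for j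
      using f[OF that] cube_bit[OF uv(1) that] by auto
  qed (simp add: f_def)
  from uso_unique_pattern[OF uso _ this, of M]
  have uniq: "\<exists>!v. v \<in> face k f \<and> (\<forall>j<k. f ! j = None \<longrightarrow> (outgoing O' v (Suc j) \<longleftrightarrow> j \<in> M))"
    by (simp add: M_def)
  have in_face: "u \<in> face k f" "v \<in> face k f"
    using uv f by (auto simp: in_face_iff)
  have "\<exists>j<k. u ! j \<noteq> v ! j \<and> O' u ! j = O' v ! j"
  proof (rule ccontr)
    assume neg: "\<not> ?thesis"
    have "outgoing O' v (Suc j) \<longleftrightarrow> outgoing O' u (Suc j)" if j: "j < k" "u ! j \<noteq> v ! j" for j
      using neg j cube_bit[OF uv(1) j(1)] cube_bit[OF uv(2) j(1)]
        cube_bit[OF O'(1) j(1)] cube_bit[OF O'(2) j(1)]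
      by (auto simp: outgoing_def)
    then have "u = v"
      using uniq in_face f by (auto simp: M_def)
    with uv show False by simp
  qed
  then obtain j where j: "j < k" "u ! j \<noteq> v ! j" "O' u ! j = O' v ! j" by blast
  then show ?thesis
    using cube_bit[OF uv(1) j(1)] cube_bit[OF uv(2) j(1)]
    by (subst separated_nth)
      (auto simp: length_encode[OF uv(1) O'(1)] length_encode[OF uv(2) O'(2)]
        nth_encode[OF uv(1) O'(1)] nth_encode[OF uv(2) O'(2)] simp del: length_map
        intro!: exI[of _ j])
qed

text \<open>Left to right, \<open>uso_separated\<close> gives separation and also injectivity of the
  encoding, hence the cardinality. Conversely, separation and counting make \<open>K\<close>
  decodable to an orientation, and a second counting argument finds the sink of each face.\<close>

theorem szabo_welzl:
  "defines_uso k K \<longleftrightarrow>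
     K \<subseteq> quat k \<and> card K = 2 ^ k \<and> (\<forall>p\<in>K. \<forall>q\<in>K. p \<noteq> q \<longrightarrow> separated p q)"
proof
  assume "defines_uso k K"
  then obtain O' where uso: "unique_sink_orientation k O'" and K: "K = encoding k O'"
    and quat: "K \<subseteq> quat k"
    by (auto simp: defines_uso_def)
  have O': "O' v \<in> cube k" if "v \<in> cube k" for v
    using that uso by (auto simp: unique_sink_orientation_def orientation_def)
  have "inj_on (\<lambda>v. encode v (O' v)) (cube k)"
  proof (rule inj_onI, rule ccontr)
    fix u v assume "u \<in> cube k" "v \<in> cube k" "encode u (O' u) = encode v (O' v)" "u \<noteq> v"
    with uso_separated[OF uso, of u v] not_separated_self show False by simp
  qed
  then have "card K = 2 ^ k"
    by (simp add: K encoding_def card_image card_cube del: One_nat_def)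
  moreover have "\<forall>p\<in>K. \<forall>q\<in>K. p \<noteq> q \<longrightarrow> separated p q"
    unfolding K encoding_def using uso_separated[OF uso] by blast
  ultimately show "K \<subseteq> quat k \<and> card K = 2 ^ k \<and>
      (\<forall>p\<in>K. \<forall>q\<in>K. p \<noteq> q \<longrightarrow> separated p q)"
    using quat by blast
next
  assume "K \<subseteq> quat k \<and> card K = 2 ^ k \<and> (\<forall>p\<in>K. \<forall>q\<in>K. p \<noteq> q \<longrightarrow> separated p q)"
  then have quat: "K \<subseteq> quat k" and card: "card K = 2 ^ k"
    and sep: "\<And>p q. p \<in> K \<Longrightarrow> q \<in> K \<Longrightarrow> p \<noteq> q \<Longrightarrow> separated p q" by auto
  \<comment> \<open>An entry is \<open>2 * a + b\<close> with vertex bit \<open>a\<close> and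
    direction bit \<open>b\<close>: the quotient by 2 recovers the vertex, the remainder the
    orientation.\<close>
  define bits where "bits = map (\<lambda>a :: nat. a div 2)"
  define dec where "dec = inv_into K bits"
  define O' where "O' = map (\<lambda>a :: nat. a mod 2) \<circ> dec"
  have len: "length p = k" if "p \<in> K" for p
    using that quat by (blast dest: nlistsE_length)
  have entry: "p ! j \<in> {0, 1, 2, 3}" if "p \<in> K" "j < k" for p j
    using that quat by (blast dest: nlistsE_nth_in)
  have sepE: "\<exists>j<k. p ! j div 2 \<noteq> q ! j div 2 \<and> p ! j mod 2 = q ! j mod 2"
    if pq: "p \<in> K" "q \<in> K" "p \<noteq> q" for p q
  proof -
    obtain j where "j < k" "p ! j + 2 = q ! j \<or> q ! j + 2 = p ! j"
      using sep[OF pq] pq by (auto simp: separated_nth len)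
    moreover have "a div 2 \<noteq> b div 2 \<and> a mod 2 = b mod 2" if "a + 2 = b" for a b :: nat
      using that by auto
    ultimately show ?thesis by metis
  qed
  have inj: "inj_on bits K"
  proof (rule inj_onI, rule ccontr)
    fix p q assume pq: "p \<in> K" "q \<in> K" "bits p = bits q" "p \<noteq> q"
    then obtain j where j: "j < k" "p ! j div 2 \<noteq> q ! j div 2" using sepE by blast
    have "bits p ! j = bits q ! j" by (simp only: pq(3))
    with j pq(1,2) show False by (simp add: bits_def len)
  qed
  \<comment> \<open>An injective image of \<open>K\<close> has \<open>2 ^ k\<close> elements, so it
    exhausts the cube: every vertex has exactly one string in \<open>K\<close>.\<close>
  have "bits ` K = cube k"
  proof (rule card_subset_eq)
    have "bits p \<in> cube k" if p: "p \<in> K" for p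
    proof (rule nlistsI_nth)
      fix j assume "j < k"
      then show "bits p ! j \<in> {0, 1}"
        using entry[OF p, of j] by (auto simp: bits_def len[OF p])
    qed (simp add: bits_def len[OF p])
    then show "bits ` K \<subseteq> cube k" by blast
    show "card (bits ` K) = card (cube k)"
      by (simp only: card_image[OF inj] card card_cube)
  qed (simp add: finite_nlists)
  have dec: "dec v \<in> K" "bits (dec v) = v" if "v \<in> cube k" for v
    unfolding dec_def using that \<open>bits ` K = cube k\<close>
    by (metis inv_into_into, metis f_inv_into_f)
  have dec_bits: "dec (bits p) = p" if "p \<in> K" for p
    unfolding dec_def using inj that by (rule inv_into_f_f)
  have dec_div: "dec v ! j div 2 = v ! j" and dec_mod: "O' v ! j = dec v ! j mod 2"
    if "v \<in> cube k" "j < k" for v j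
  proof -
    have j: "j < length (dec v)" using len[OF dec(1)[OF that(1)]] that(2) by simp
    have "bits (dec v) ! j = v ! j" by (simp only: dec(2)[OF that(1)])
    with j show "dec v ! j div 2 = v ! j" by (simp add: bits_def)
    from j show "O' v ! j = dec v ! j mod 2" by (simp add: O'_def)
  qed
  have O': "O' v \<in> cube k" if "v \<in> cube k" for v
  proof (rule nlistsI_nth)
    show "O' v ! j \<in> {0, 1}" if "j < k" for j
      using dec_mod[OF \<open>v \<in> cube k\<close> that] by auto
    show "length (O' v) = k"
      using len[OF dec(1)[OF that]] by (simp add: O'_def)
  qed
  have differ: "\<exists>j<k. v ! j \<noteq> w ! j \<and> O' v ! j = O' w ! j"
    if vw: "v \<in> cube k" "w \<in> cube k" "v \<noteq> w" for v w
  proof -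
    have "dec v \<noteq> dec w" using dec(2) vw by metis
    from sepE[OF dec(1)[OF vw(1)] dec(1)[OF vw(2)] this] show ?thesis
      using dec_div[OF vw(1)] dec_div[OF vw(2)] dec_mod[OF vw(1)] dec_mod[OF vw(2)] by auto
  qed
  have "orientation k O'"
    unfolding orientation_def ball_1_atMost
  proof (intro ballI conjI allI impI)
    fix v n assume v: "v \<in> cube k" and n: "n < k"
    \<comment> \<open>The two vertices differ only in coordinate \<open>n\<close>, so this
      \<open>j\<close> must be \<open>n\<close>, and both ends agree on the direction of their
      edge.\<close>
    obtain j where "j < k" "v ! j \<noteq> flip v (Suc n) ! j" "O' v ! j = O' (flip v (Suc n)) ! j"
      using differ[OF v flip_in_cube[OF v, of n]] flip_neq[OF v n] by metis
    moreover have "length v = k" using v by (rule nlistsE_length)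
    ultimately show "O' v ! (Suc n - 1) = O' (flip v (Suc n)) ! (Suc n - 1)"
      by (auto simp: nth_flip_Suc split: if_splits)
  qed (rule O')
  moreover have "\<exists>!v. face_sink k O' f v" if f: "f \<in> nlists k {None, Some 0, Some 1}" for f
  proof -
    \<comment> \<open>Outgoing pattern in the free directions, vertex bits in the fixed ones. At the
      \<open>j\<close> from \<open>differ\<close> the vertex bits differ and the direction bits
      agree, so \<open>g v\<close> and \<open>g w\<close> differ there in either case;
      \<open>g\<close> is therefore a bijection of the cube.\<close>
    define g where "g v = map (\<lambda>j. if f ! j = None then of_bool (outgoing O' v (Suc j))
      else v ! j) [0..<k]" for v
    have g: "g v ! j = (if f ! j = None then of_bool (outgoing O' v (Suc j)) else v ! j)"
      if "j < k" for j v
      using that by (simp add: g_def)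
    have g_inj: "inj_on g (cube k)"
    proof (rule inj_onI, rule ccontr)
      fix v w assume vw: "v \<in> cube k" "w \<in> cube k" "g v = g w" "v \<noteq> w"
      obtain j where j: "j < k" "v ! j \<noteq> w ! j" "O' v ! j = O' w ! j"
        using differ vw by metis
      have "g v ! j = g w ! j" using vw by simp
      then show False
        using j cube_bit[OF vw(1) j(1)] cube_bit[OF vw(2) j(1)] cube_bit[OF O'[OF vw(1)] j(1)]
        by (auto simp: g outgoing_def split: if_splits)
    qed
    moreover have "g v \<in> cube k" if "v \<in> cube k" for v
    proof (rule nlistsI_nth)
      show "g v ! j \<in> {0, 1}" if "j < k" for j
        using cube_bit[OF \<open>v \<in> cube k\<close> that] by (auto simp: g[OF that])
    qed (simp add: g_def)
    then have "g ` cube k \<subseteq> cube k" by blast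
    ultimately have g_surj: "g ` cube k = cube k"
      by (intro endo_inj_surj) (simp_all add: finite_nlists)
    \<comment> \<open>The value of \<open>g\<close> at a sink of \<open>f\<close>: 0 for no outgoing
      edge in free directions, the prescribed bit elsewhere.\<close>
    define z where "z = map (\<lambda>j. case f ! j of None \<Rightarrow> 0 | Some b \<Rightarrow> b) [0..<k]"
    have "z ! j \<in> {0, 1}" if "j < k" for j
      using nlistsE_nth_in[OF f that] that by (auto simp: z_def)
    then have "z \<in> cube k" by (intro nlistsI_nth) (simp_all add: z_def)
    have sink_iff: "face_sink k O' f v \<longleftrightarrow> v \<in> cube k \<and> g v = z" for v
      unfolding face_sink_iff in_face_iff g_def z_def by (auto split: option.splits)
    show ?thesis
      unfolding sink_iff
    proof (rule ex_ex1I)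
      have "z \<in> g ` cube k" using \<open>z \<in> cube k\<close> by (simp only: g_surj)
      then show "\<exists>v. v \<in> cube k \<and> g v = z" by blast
    qed (use g_inj in \<open>auto dest: inj_onD\<close>)
  qed
  ultimately have "unique_sink_orientation k O'"
    unfolding unique_sink_orientation_def by (intro conjI ballI)
  moreover have "K = encoding k O'"
  proof -
    have "encode v (O' v) = dec v" if v: "v \<in> cube k" for v
    proof (rule nth_equalityI)
      show "length (encode v (O' v)) = length (dec v)"
        using length_encode[OF v O'[OF v]] dec[OF v] len by simp
      fix j assume "j < length (encode v (O' v))"
      then have "j < k" by (simp only: length_encode[OF v O'[OF v]])
      then show "encode v (O' v) ! j = dec v ! j"
        using nth_encode[OF v O'[OF v]] dec_div[OF v, symmetric] dec_mod[OF v] by simp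
    qed
    then have "encoding k O' = dec ` cube k" by (simp add: encoding_def)
    also have "\<dots> = K"
      unfolding \<open>bits ` K = cube k\<close>[symmetric] image_image using dec_bits by simp
    finally show ?thesis by simp
  qed
  ultimately show "defines_uso k K"
    using quat unfolding defines_uso_def by (intro conjI exI)
qed

section \<open>Consequences for pairs of strings and for sums over a USO\<close>

lemma defines_uso_separated:
  "defines_uso k K \<Longrightarrow> p \<in> K \<Longrightarrow> q \<in> K \<Longrightarrow> p \<noteq> q \<Longrightarrow> separated p q"
  unfolding szabo_welzl by blast

text \<open>The ends of an edge in direction \<open>n\<close> agree on its direction, so their
  symbols there are 0 and 2 or 1 and 3, and together they contribute \<open>C\<close>. Summing over
  all vertices and their flips meets every edge twice, which explains the factor 2.\<close>

lemma sum_uso_coordinate: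
  fixes c :: "nat \<Rightarrow> nat"
  assumes "defines_uso k K" "n < k" "c 0 + c 2 = C" "c 1 + c 3 = C"
  shows "2 * (\<Sum>p\<in>K. c (p ! n)) = 2 ^ k * C"
proof -
  obtain O' where uso: "unique_sink_orientation k O'" and K: "K = encoding k O'"
    using assms by (auto simp: defines_uso_def)
  have O': "O' v \<in> cube k" "O' (flip v (Suc n)) ! n = O' v ! n" if "v \<in> cube k" for v
    using that uso \<open>n < k\<close>
    unfolding unique_sink_orientation_def orientation_def ball_1_atMost by auto
  have "card (encoding k O') = card (cube k)"
    using assms(1) unfolding szabo_welzl K card_cube by blast
  then have inj: "inj_on (\<lambda>v. encode v (O' v)) (cube k)"
    unfolding encoding_def by (intro eq_card_imp_inj_on finite_nlists) auto
  define s where "s v = c (2 * v ! n + O' v ! n)" for v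
  have "(\<Sum>p\<in>K. c (p ! n)) = (\<Sum>v\<in>cube k. c (encode v (O' v) ! n))"
    unfolding K encoding_def by (simp only: sum.reindex[OF inj] comp_def)
  also have "\<dots> = (\<Sum>v\<in>cube k. s v)"
    by (rule sum.cong) (use O' \<open>n < k\<close> in \<open>simp_all add: s_def nth_encode\<close>)
  finally have sum1: "(\<Sum>p\<in>K. c (p ! n)) = (\<Sum>v\<in>cube k. s v)" .
  have sum2: "(\<Sum>v\<in>cube k. s v) = (\<Sum>v\<in>cube k. s (flip v (Suc n)))"
    by (rule sum.reindex_bij_witness[of _ "\<lambda>v. flip v (Suc n)" "\<lambda>v. flip v (Suc n)"])
      (simp_all add: flip_flip flip_in_cube del: One_nat_def)
  have "s v + s (flip v (Suc n)) = C" if v: "v \<in> cube k" for v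
  proof -
    have "flip v (Suc n) ! n = 1 - v ! n"
      using nlistsE_length[OF v] \<open>n < k\<close> by (simp add: nth_flip_Suc)
    then show ?thesis
      using cube_bit[OF v \<open>n < k\<close>] cube_bit[OF O'(1)[OF v] \<open>n < k\<close>] O'(2)[OF v] assms(3,4)
      by (auto simp: s_def add.commute simp flip: numeral_2_eq_2 simp del: One_nat_def)
  qed
  then have "(\<Sum>v\<in>cube k. s v + s (flip v (Suc n))) = 2 ^ k * C"
    by (simp add: card_cube del: One_nat_def)
  then show ?thesis
    using sum1 sum2 by (simp add: sum.distrib)
qed

section \<open>Separation and cardinality of the rewritten set\<close>

theorem lemma22:
  fixes k d i h :: nat
    and S :: "nat \<Rightarrow> nat \<Rightarrow> nat list set"
    and K :: "nat list set"
    and L :: "nat list \<Rightarrow> nat"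
  assumes "k \<ge> 1" and "d \<ge> 0" and "i \<ge> 1"
    and "generalized_rewriting_rule d i S"
    and "h \<in> {1..k}"
    and "defines_uso k K"
    and "L \<in> K \<rightarrow> {1..i}"
  shows "defines_uso (k + d - 1) (apply_rule S h K L)"
proof -
  \<comment> \<open>\<open>n\<close> is the list index of the 1-based coordinate
    \<open>h\<close>.\<close>
  obtain n where h: "h = Suc n" and n: "n < k"
    using assms(5) by (cases h) auto
  have K: "K \<subseteq> quat k" "card K = 2 ^ k"
    and K_sep: "\<And>p q. p \<in> K \<Longrightarrow> q \<in> K \<Longrightarrow> p \<noteq> q \<Longrightarrow> separated p q"
    using assms(6) by (auto simp: szabo_welzl)
  have "finite K" using K(1) by (rule finite_subset) (simp add: finite_nlists)
  have L: "L p \<in> {1..i}" if "p \<in> K" for p using assms(7) that by blast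
  have S_quat: "S m j \<subseteq> quat d" if "m \<in> {0, 1, 2, 3}" "j \<in> {1..i}" for m j
    using assms(4) that unfolding generalized_rewriting_rule_def by blast
  have S_fin: "finite (S m j)" if "m \<in> {0, 1, 2, 3}" "j \<in> {1..i}" for m j
    using S_quat[OF that] by (rule finite_subset) (simp add: finite_nlists)
  \<comment> \<open>The pairs \<open>(m, m')\<close> treat both conditions of the rule at
    once.\<close>
  have S_pair: "S m j \<inter> S m' j' = {}" "defines_uso d (S m j \<union> S m' j')"
    if "(m, m') \<in> {(0, 2), (1, 3)}" "j \<in> {1..i}" "j' \<in> {1..i}" for m m' j j'
  proof -
    have "S 0 j \<inter> S 2 j' = {} \<and> defines_uso d (S 0 j \<union> S 2 j') \<and>
      S 1 j \<inter> S 3 j' = {} \<and> defines_uso d (S 1 j \<union> S 3 j')"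
      using assms(4) that(2,3) unfolding generalized_rewriting_rule_def by blast
    then show "S m j \<inter> S m' j' = {}" "defines_uso d (S m j \<union> S m' j')"
      using that(1) by auto
  qed
  have S_card: "card (S m j) + card (S m' j') = 2 ^ d"
    if m: "(m, m') \<in> {(0, 2), (1, 3)}" and j: "j \<in> {1..i}" "j' \<in> {1..i}" for m m' j j'
  proof -
    have "finite (S m j)" "finite (S m' j')" using m j by (auto intro!: S_fin)
    then show ?thesis
      using S_pair[OF m j] by (simp add: szabo_welzl card_Un_disjoint)
  qed
  have S_cross: "separated t t' \<and> separated t' t"
    if "(m, m') \<in> {(0, 2), (1, 3)}" "j \<in> {1..i}" "j' \<in> {1..i}" "t \<in> S m j" "t' \<in> S m' j'"
    for m m' j j' t t'
    using S_pair[OF that(1-3)] that(4,5) by (auto intro!: defines_uso_separated)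
  \<comment> \<open>Label 1 serves as the reference label for the partner set: it completes
    \<open>S m j\<close> to a USO and makes \<open>card (S m j)\<close> comparable across all
    \<open>j\<close>.\<close>
  have one: "1 \<in> {1..i}" using assms(3) by simp
  have S_same: "separated t t'"
    if m: "m \<in> {0, 1, 2, 3}" and j: "j \<in> {1..i}" and t: "t \<in> S m j" "t' \<in> S m j" "t \<noteq> t'"
    for m j t t'
  proof -
    obtain m' :: nat where "(m, m') \<in> {(0, 2), (1, 3)} \<or> (m', m) \<in> {(0, 2), (1, 3)}"
      using m by auto
    then show ?thesis
    proof
      assume 1: "(m, m') \<in> {(0, 2), (1, 3)}"
      show ?thesis using defines_uso_separated[OF S_pair(2)[OF 1 j one]] t by blast
    next
      assume 2: "(m', m) \<in> {(0, 2), (1, 3)}"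
      show ?thesis using defines_uso_separated[OF S_pair(2)[OF 2 one j]] t by blast
    qed
  qed
  have S_card_1: "card (S m j) = card (S m 1)" if "m \<in> {0, 1, 2, 3}" "j \<in> {1..i}" for m j
  proof -
    obtain m' :: nat where "(m, m') \<in> {(0, 2), (1, 3)} \<or> (m', m) \<in> {(0, 2), (1, 3)}"
      using \<open>m \<in> {0, 1, 2, 3}\<close> by auto
    then show ?thesis
    proof
      assume 1: "(m, m') \<in> {(0, 2), (1, 3)}"
      show ?thesis using S_card[OF 1 \<open>j \<in> {1..i}\<close> one] S_card[OF 1 one one] by linarith
    next
      assume 2: "(m', m) \<in> {(0, 2), (1, 3)}"
      show ?thesis using S_card[OF 2 one \<open>j \<in> {1..i}\<close>] S_card[OF 2 one one] by linarith
    qed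
  qed

  define sub where "sub p t = take n p @ t @ drop (Suc n) p" for p t :: "nat list"
  define T where "T p = S (p ! n) (L p)" for p
  have result: "apply_rule S h K L = (\<Union>p\<in>K. sub p ` T p)"
    unfolding apply_rule_def h sub_def T_def by auto
  have p_len: "length p = k" and p_n: "p ! n \<in> {0, 1, 2, 3}" if "p \<in> K" for p
    using that K(1) n by (blast dest: nlistsE_length nlistsE_nth_in)+
  have T_quat: "T p \<subseteq> quat d" if "p \<in> K" for p
    unfolding T_def using that by (intro S_quat p_n L)
  have T_len: "length t = d" if "p \<in> K" "t \<in> T p" for p t
    using T_quat that by (blast dest: nlistsE_length)
  have sub_sep: "separated (sub p t) (sub q u) \<longleftrightarrow>
      separated (take n p) (take n q) \<or> separated t u \<or>
      separated (drop (Suc n) p) (drop (Suc n) q)"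
    if "p \<in> K" "q \<in> K" "length t = length u" for p q t u
    using that by (simp add: sub_def separated_append p_len)
  have sep: "separated (sub p t) (sub q u)"
    if pq: "p \<in> K" "q \<in> K" and tu: "t \<in> T p" "u \<in> T q" and neq: "p \<noteq> q \<or> t \<noteq> u" for p q t u
  proof (cases "p = q")
    \<comment> \<open>Both blocks come from the same set with the same label, so they are distinct
      members of one USO.\<close>
    case True
    then have "separated t u"
      using S_same[OF p_n[OF pq(1)] L[OF pq(1)]] tu neq by (auto simp: T_def)
    then show ?thesis using sub_sep pq tu T_len by simp
  next
    case False
    have "separated (take n p @ p ! n # drop (Suc n) p) (take n q @ q ! n # drop (Suc n) q)"
      using K_sep[OF pq False] n pq by (simp add: p_len flip: id_take_nth_drop)
    then consider "separated (take n p) (take n q)"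
      | "p ! n + 2 = q ! n \<or> q ! n + 2 = p ! n"
      | "separated (drop (Suc n) p) (drop (Suc n) q)"
      using pq by (auto simp: separated_append separated_Cons p_len)
    then have "separated (take n p) (take n q) \<or> separated t u \<or>
      separated (drop (Suc n) p) (drop (Suc n) q)"
    proof cases
      \<comment> \<open>The symbols at \<open>n\<close> are 0 and 2 or 1 and 3, while the labels of
        \<open>p\<close> and \<open>q\<close> may differ. Here the rule is used for mixed labels
        \<open>j\<close> and \<open>j'\<close>.\<close>
      case 2
      then show ?thesis
      proof
        assume e: "p ! n + 2 = q ! n"
        then have "(p ! n, q ! n) \<in> {(0, 2), (1, 3)}" using p_n[OF pq(2)] by auto
        from S_cross[OF this L[OF pq(1)] L[OF pq(2)]] show ?thesis
          using tu by (simp add: T_def)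
      next
        assume e: "q ! n + 2 = p ! n"
        then have "(q ! n, p ! n) \<in> {(0, 2), (1, 3)}" using p_n[OF pq(1)] by auto
        from S_cross[OF this L[OF pq(2)] L[OF pq(1)]] show ?thesis
          using tu by (simp add: T_def)
      qed
    qed auto
    then show ?thesis using sub_sep pq tu T_len by simp
  qed
  \<comment> \<open>Separated strings are distinct, so \<open>sep\<close> makes the union
    disjoint.\<close>
  have "card (\<Union>p\<in>K. sub p ` T p) = (\<Sum>p\<in>K. card (sub p ` T p))"
  proof (rule card_UN_disjoint)
    show "\<forall>p\<in>K. finite (sub p ` T p)"
      unfolding T_def using S_fin[OF p_n L] by blast
    show "\<forall>p\<in>K. \<forall>q\<in>K. p \<noteq> q \<longrightarrow> sub p ` T p \<inter> sub q ` T q = {}"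
    proof (intro ballI impI)
      fix p q assume pq: "p \<in> K" "q \<in> K" "p \<noteq> q"
      have "sub p t \<noteq> sub q u" if "t \<in> T p" "u \<in> T q" for t u
        using sep[OF pq(1,2) that] pq(3) not_separated_self by metis
      then show "sub p ` T p \<inter> sub q ` T q = {}" by blast
    qed
  qed fact
  \<comment> \<open>Replacing the label by 1 leaves summands that depend only on the symbol
    \<open>p ! n\<close>, as \<open>sum_uso_coordinate\<close> requires.\<close>
  also have "\<dots> = (\<Sum>p\<in>K. card (S (p ! n) 1))"
  proof (rule sum.cong)
    fix p assume p: "p \<in> K"
    have "inj_on (sub p) (T p)" by (simp add: inj_on_def sub_def)
    then show "card (sub p ` T p) = card (S (p ! n) 1)"
      using S_card_1[OF p_n[OF p] L[OF p]] by (simp add: card_image T_def)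
  qed simp
  finally have "2 * card (apply_rule S h K L) = 2 ^ k * 2 ^ d"
    using sum_uso_coordinate[OF assms(6) n, of "\<lambda>m. card (S m 1)" "2 ^ d"]
      S_card[of 0 2 1 1] S_card[of 1 3 1 1] one
    by (simp add: result)
  \<comment> \<open>The truncated subtraction is exact because \<open>k \<ge> 1\<close>.\<close>
  also have "\<dots> = 2 * 2 ^ (k + d - 1)"
    using assms(1) by (cases k) (simp_all add: power_add)
  finally have "card (apply_rule S h K L) = 2 ^ (k + d - 1)" by simp
  moreover have "apply_rule S h K L \<subseteq> quat (k + d - 1)"
  proof -
    have "sub p t \<in> quat (k + d - 1)" if "p \<in> K" "t \<in> T p" for p t
    proof -
      have "p \<in> quat k" "t \<in> quat d" using that K(1) T_quat by blast+
      from this[THEN nlistsE_set] have "set (sub p t) \<subseteq> {0, 1, 2, 3}"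
        using set_take_subset[of n p] set_drop_subset[of "Suc n" p]
        unfolding sub_def set_append by blast
      moreover have "length (sub p t) = k + d - 1"
        using p_len[OF that(1)] T_len[OF that] n by (simp add: sub_def)
      ultimately show ?thesis by (intro nlistsI)
    qed
    then show ?thesis unfolding result by blast
  qed
  moreover have "separated x y"
    if xy: "x \<in> apply_rule S h K L" "y \<in> apply_rule S h K L" "x \<noteq> y" for x y
  proof -
    obtain p t q u where "p \<in> K" "t \<in> T p" "x = sub p t" "q \<in> K" "u \<in> T q" "y = sub q u"
      using xy(1,2) unfolding result by blast
    then show ?thesis using xy(3) sep[of p q t u] by blast
  qed
  ultimately show ?thesis unfolding szabo_welzl by blast
qed

end
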